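(* For every integer $t\ge3$ and $\delta\in(0,1/(2t-3))$ there exists $n_0$ such that every $(n,d,\lambda)$-graph $G$ with $n\ge n_0$, $d\le n^{1-\delta}$ and $\lambda\le\frac{1}{50t\,4^{t-2}}\frac{d^{t-1}}{n^{t-2}}$ contains $\ell=n^{\delta/(4t^2)}$ fractional $K_t$-factors $f_1,\dots,f_\ell$ such that \[ \sum_{i=1}^\ell\sum_{T\in\mathcal{K}_t(G):\,V(T)\supseteq\{u,v\}}f_i(T)\le1\quad\text{for every edge }uv\in E(G). \]
   Context: An $(n,d,\lambda)$-graph is an $n$-vertex $d$-regular graph whose second largest eigenvalue in absolute value is at most $\lambda$. $\mathcal{K}_t(G)$ is the set of copies of $K_t$ in $G$. A fractional $K_t$-factor of $G$ is a function $f\colon\mathcal{K}_t(G)\to[0,1]$ with $\sum_{T\in\mathcal{K}_t(G):V(T)\ni v}f(T)=1$ for every vertex $v$. Floors and ceilings are omitted.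
   Formalization: The formal statement adds the assumption d ≥ 1: for d = 0 the empty graph with λ = 0 meets every hypothesis but contains no K_t, so the claim fails there. *)

theory Defs
  imports "Jordan_Normal_Form.Char_Poly" "HOL-Library.Multiset"
begin

text \<open>Finite simple graphs on \<open>n\<close> vertices, labelled by \<open>0, \<dots>, n - 1\<close>;
  \<open>E u v\<close> means that \<open>uv\<close> is an edge.\<close>

definition simple_graph :: "nat \<Rightarrow> (nat \<Rightarrow> nat \<Rightarrow> bool) \<Rightarrow> bool" where
  "simple_graph n E \<longleftrightarrow>
     (\<forall>u v. E u v \<longrightarrow> u < n \<and> v < n \<and> u \<noteq> v \<and> E v u)"

definition regular_graph :: "nat \<Rightarrow> nat \<Rightarrow> (nat \<Rightarrow> nat \<Rightarrow> bool) \<Rightarrow> bool" where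
  "regular_graph n d E \<longleftrightarrow> (\<forall>u<n. card {v. v < n \<and> E u v} = d)"

definition adjacency_mat :: "nat \<Rightarrow> (nat \<Rightarrow> nat \<Rightarrow> bool) \<Rightarrow> real mat" where
  "adjacency_mat n E = mat n n (\<lambda>(i, j). if E i j then 1 else 0)"

text \<open>The adjacency matrix is real symmetric, so the multiset \<open>proots\<close> of the real roots of its
  characteristic polynomial consists of all \<open>n\<close> eigenvalues, with multiplicity. Their absolute
  values are listed in decreasing order, and the entry at index 1 is the second largest; it is
  unspecified when \<open>n < 2\<close>.\<close>

definition second_abs_eigenvalue :: "nat \<Rightarrow> (nat \<Rightarrow> nat \<Rightarrow> bool) \<Rightarrow> real" where
  "second_abs_eigenvalue n E =
     rev (sorted_list_of_multiset
            (image_mset abs (proots (char_poly (adjacency_mat n E))))) ! 1"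

definition ndl_graph :: "nat \<Rightarrow> nat \<Rightarrow> real \<Rightarrow> (nat \<Rightarrow> nat \<Rightarrow> bool) \<Rightarrow> bool" where
  "ndl_graph n d lam E \<longleftrightarrow>
     simple_graph n E \<and> regular_graph n d E \<and> second_abs_eigenvalue n E \<le> lam"

text \<open>A copy of \<open>K\<^sub>t\<close> is determined by its vertex set.\<close>

definition clique_copies :: "nat \<Rightarrow> nat \<Rightarrow> (nat \<Rightarrow> nat \<Rightarrow> bool) \<Rightarrow> nat set set" where
  "clique_copies t n E =
     {T. T \<subseteq> {..<n} \<and> card T = t \<and> (\<forall>u\<in>T. \<forall>v\<in>T. u \<noteq> v \<longrightarrow> E u v)}"

definition fractional_clique_factor ::
    "nat \<Rightarrow> nat \<Rightarrow> (nat \<Rightarrow> nat \<Rightarrow> bool) \<Rightarrow> (nat set \<Rightarrow> real) \<Rightarrow> bool" where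
  "fractional_clique_factor t n E f \<longleftrightarrow>
     (\<forall>T\<in>clique_copies t n E. 0 \<le> f T \<and> f T \<le> 1) \<and>
     (\<forall>v<n. (\<Sum>T\<in>{T \<in> clique_copies t n E. v \<in> T}. f T) = 1)"

end

theory Submission
  imports Defs "HOL-Analysis.Convex" "HOL-Analysis.Function_Topology" "HOL-Real_Asymp.Real_Asymp"
begin

text \<open>
  All the factors can be taken equal: it suffices to find \<open>g \<ge> 0\<close> on the copies of \<open>K\<^sub>t\<close> with
  weight \<open>2\<ell>\<close> at every vertex and at most \<open>2\<close> on every edge, and then \<open>f\<^sub>1 = \<dots> = f\<^sub>\<ell> = g / (2\<ell>)\<close>.
  Such a \<open>g\<close> is a sum of \<open>2\<ell>\<close> fractional factors, each chosen in the subgraph of the edges whose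
  load so far is at most \<open>1\<close>. As the load at a vertex is at most \<open>2\<ell>(t - 1)\<close>, at most that many edges
  are lost at each vertex, which is below \<open>\<lambda>\<close>: indeed \<open>\<lambda>\<^sup>2 \<ge> d / 4\<close>, and with \<open>\<lambda> \<le> d\<^sup>2 / n\<close> this
  makes \<open>\<lambda>\<close> of order at least \<open>n\<^bsup>1/3\<^esup>\<close>.

  If such a subgraph had no fractional factor, Farkas' lemma would give vertex weights \<open>x\<close> with
  negative total but nonnegative sum on every \<open>K\<^sub>t\<close>. By the expander mixing lemma, whenever
  \<open>A\<close> and \<open>W\<close> are disjoint and \<open>|W| < (t - 1)|A|\<close>, some \<open>K\<^sub>t\<close> meets \<open>A\<close> and avoids \<open>W\<close>. Applied to
  \<open>A = {x \<le> -s}\<close> and \<open>W = {x \<ge> s / (t - 1)}\<close> this yields \<open>|W| \<ge> (t - 1)|A|\<close> for all \<open>s > 0\<close>, and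
  integrating over \<open>s\<close> shows that the total weight is nonnegative.
\<close>

section \<open>Fractional perfect matchings\<close>

text \<open>Induction on the generators \<open>a i\<close>. If a vector separating \<open>b\<close>
  from the cone over \<open>I\<close> is negative on the new generator \<open>a j\<close>, all
  functionals are projected along it and the induction hypothesis is applied to the
  projections.\<close>

lemma farkas:
  fixes a :: "'i \<Rightarrow> 'v \<Rightarrow> real"
  assumes "finite I" and V: "finite V"
  shows "(\<exists>c. (\<forall>i\<in>I. 0 \<le> c i) \<and> (\<forall>v\<in>V. b v = (\<Sum>i\<in>I. c i * a i v))) \<or>
         (\<exists>x. (\<forall>i\<in>I. 0 \<le> (\<Sum>v\<in>V. a i v * x v)) \<and> (\<Sum>v\<in>V. b v * x v) < 0)"
  using assms(1)
proof (induction I arbitrary: a b)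
  case empty
  show ?case
  proof (cases "\<forall>v\<in>V. b v = 0")
    case False
    then obtain v where "v \<in> V" "b v \<noteq> 0" by blast
    then have "(\<Sum>v\<in>V. b v * b v) > 0"
      by (intro sum_pos2[OF V]) (auto simp: zero_less_mult_iff less_le)
    then have "(\<Sum>v\<in>V. b v * (- b v)) < 0" by (simp add: sum_negf)
    then show ?thesis by (intro disjI2 exI[of _ "\<lambda>v. - b v"]) simp
  qed auto
next
  case (insert j I)
  define ip where "ip = (\<lambda>(p::'v \<Rightarrow> real) x. \<Sum>v\<in>V. p v * x v)"
  have ip_right: "ip p (\<lambda>v. y v + s * z v) = ip p y + s * ip p z" for p y z s
    by (simp add: ip_def distrib_left sum.distrib sum_distrib_left mult.left_commute)
  have ip_left: "ip (\<lambda>v. p v + s * q v) y = ip p y + s * ip q y" for p q y s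
    by (simp add: ip_def distrib_right sum.distrib sum_distrib_left mult.assoc)
  consider (comb) c where "\<forall>i\<in>I. 0 \<le> c i" "\<forall>v\<in>V. b v = (\<Sum>i\<in>I. c i * a i v)"
    | (sep) x where "\<forall>i\<in>I. 0 \<le> ip (a i) x" "ip b x < 0"
    using insert.IH[of b a] unfolding ip_def by blast
  then show ?case
  proof cases
    case comb
    have "(\<Sum>i\<in>insert j I. (c(j := 0)) i * a i v) = (\<Sum>i\<in>I. c i * a i v)" for v
      using insert.hyps by (simp, intro sum.cong) auto
    with comb have "(\<forall>i\<in>insert j I. 0 \<le> (c(j := 0)) i) \<and>
        (\<forall>v\<in>V. b v = (\<Sum>i\<in>insert j I. (c(j := 0)) i * a i v))" by simp
    then show ?thesis by blast
  next
    case sep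
    show ?thesis
    proof (cases "0 \<le> ip (a j) x")
      case True
      with sep have "(\<forall>i\<in>insert j I. 0 \<le> ip (a i) x) \<and> ip b x < 0" by simp
      then show ?thesis unfolding ip_def by blast
    next
      case False
      define z where "z = (\<lambda>v. 0 + (- 1 / ip (a j) x) * x v)"
      have ipz: "ip p z = - ip p x / ip (a j) x" for p
        unfolding z_def ip_right by (simp add: ip_def)
      have zj: "ip (a j) z = -1" using False by (simp add: ipz)
      have zi: "\<forall>i\<in>I. 0 \<le> ip (a i) z" and zb: "ip b z < 0"
        using sep False by (auto simp: ipz field_simps divide_le_0_iff divide_less_0_iff)
      \<comment> \<open>project all constraints along \<open>z\<close> onto functionals vanishing at \<open>z\<close>\<close>
      define a' where "a' = (\<lambda>i v. a i v + ip (a i) z * a j v)"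
      define b' where "b' = (\<lambda>v. b v + ip b z * a j v)"
      consider (comb') c where "\<forall>i\<in>I. 0 \<le> c i" "\<forall>v\<in>V. b' v = (\<Sum>i\<in>I. c i * a' i v)"
        | (sep') y where "\<forall>i\<in>I. 0 \<le> ip (a' i) y" "ip b' y < 0"
        using insert.IH[of b' a'] unfolding ip_def by blast
      then show ?thesis
      proof cases
        case comb'
        define c' where "c' = c(j := (\<Sum>i\<in>I. c i * ip (a i) z) - ip b z)"
        have nonneg: "\<forall>i\<in>insert j I. 0 \<le> c' i"
        proof -
          have "0 \<le> (\<Sum>i\<in>I. c i * ip (a i) z)" using comb' zi by (intro sum_nonneg) simp
          then show ?thesis using comb' zb by (auto simp: c'_def)
        qed
        have "b v = (\<Sum>i\<in>insert j I. c' i * a i v)" if "v \<in> V" for v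
        proof -
          have "(\<Sum>i\<in>I. c' i * a i v) = (\<Sum>i\<in>I. c i * a i v)"
            using insert.hyps by (intro sum.cong) (auto simp: c'_def)
          moreover have "b v + ip b z * a j v
              = (\<Sum>i\<in>I. c i * a i v) + (\<Sum>i\<in>I. c i * ip (a i) z) * a j v"
            using comb'(2) that unfolding b'_def a'_def
            by (simp add: distrib_left sum.distrib sum_distrib_right mult.assoc)
          ultimately show ?thesis using insert.hyps by (simp add: c'_def algebra_simps)
        qed
        with nonneg show ?thesis by blast
      next
        case sep'
        define w where "w = (\<lambda>v. y v + ip (a j) y * z v)"
        have "ip (a' i) y = ip (a i) w" for i
          unfolding a'_def w_def ip_left ip_right by (simp add: mult.commute)
        moreover have "ip b' y = ip b w"
          unfolding b'_def w_def ip_left ip_right by (simp add: mult.commute)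
        moreover have "ip (a j) w = 0" unfolding w_def ip_right zj by simp
        ultimately have "(\<forall>i\<in>insert j I. 0 \<le> ip (a i) w) \<and> ip b w < 0" using sep' by simp
        then show ?thesis unfolding ip_def by blast
      qed
    qed
  qed
qed

text \<open>A discrete layer-cake argument: each total is the integral over \<open>s\<close> of the
  superlevel counts. Induction on the number of points with \<open>p\<close> positive replaces the
  integral.\<close>

lemma sum_le_of_card_superlevel_le:
  fixes p q :: "'a \<Rightarrow> real"
  assumes V: "finite V" and "\<And>v. v \<in> V \<Longrightarrow> 0 \<le> p v" and "\<And>v. v \<in> V \<Longrightarrow> 0 \<le> q v"
    and "\<And>s. 0 < s \<Longrightarrow> k * card {v \<in> V. s \<le> p v} \<le> card {v \<in> V. s \<le> q v}"
  shows "real k * (\<Sum>v\<in>V. p v) \<le> (\<Sum>v\<in>V. q v)"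
  using assms(2-)
proof (induction "card {v \<in> V. 0 < p v}" arbitrary: p q rule: less_induct)
  case less
  define P where "P = {v \<in> V. 0 < p v}"
  have finP: "finite P" using V by (simp add: P_def)
  show ?case
  proof (cases "P = {}")
    case True
    then have "p v = 0" if "v \<in> V" for v using that less.prems(1)[of v] by (auto simp: P_def)
    then show ?thesis using less.prems(2) by (simp add: sum_nonneg)
  next
    case False
    \<comment> \<open>peel off the lowest layer, of height the least positive value of \<open>p\<close>\<close>
    define m where "m = Min (p ` P)"
    have m_le: "m \<le> p v" if "v \<in> P" for v using that finP by (simp add: m_def)
    obtain u where u: "u \<in> P" "p u = m"
      using Min_in[of "p ` P"] False finP unfolding m_def by fastforce
    have m0: "0 < m" using u by (auto simp: P_def)
    \<comment> \<open>Cutting off height \<open>m\<close> removes \<open>u\<close> from the support,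
      and the superlevel sets of \<open>p'\<close> and \<open>q'\<close> at \<open>s\<close> are
      those of \<open>p\<close> and \<open>q\<close> at \<open>s + m\<close>.\<close>
    define p' where "p' = (\<lambda>v. max 0 (p v - m))"
    define q' where "q' = (\<lambda>v. max 0 (q v - m))"
    have "{v \<in> V. 0 < p' v} \<subseteq> P" using m0 by (auto simp: P_def p'_def)
    moreover have "u \<notin> {v \<in> V. 0 < p' v}" using u by (simp add: p'_def)
    ultimately have "{v \<in> V. 0 < p' v} \<subset> P" using u(1) by blast
    then have "card {v \<in> V. 0 < p' v} < card {v \<in> V. 0 < p v}"
      using finP psubset_card_mono unfolding P_def by blast
    moreover have "k * card {v \<in> V. s \<le> p' v} \<le> card {v \<in> V. s \<le> q' v}" if "0 < s" for s
    proof -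
      have "{v \<in> V. s \<le> p' v} = {v \<in> V. s + m \<le> p v}" "{v \<in> V. s \<le> q' v} = {v \<in> V. s + m \<le> q v}"
        using that by (auto simp: p'_def q'_def)
      then show ?thesis using less.prems(3)[of "s + m"] that m0 by simp
    qed
    ultimately have IH: "real k * (\<Sum>v\<in>V. p' v) \<le> (\<Sum>v\<in>V. q' v)"
      by (intro less.hyps) (auto simp: p'_def q'_def)
    have PV: "P = {v \<in> V. m \<le> p v}" using m_le m0 by (force simp: P_def)
    have ind: "(\<Sum>v\<in>V. if m \<le> r v then m else 0) = m * card {v \<in> V. m \<le> r v}" for r :: "'a \<Rightarrow> real"
      using V by (simp add: sum.If_cases Int_def)
    have "p v = p' v + (if m \<le> p v then m else 0)" if "v \<in> V" for v
    proof (cases "v \<in> P")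
      case True then show ?thesis using m_le by (simp add: p'_def)
    next
      case False then show ?thesis using that m0 less.prems(1)[of v] by (force simp: P_def p'_def)
    qed
    then have "(\<Sum>v\<in>V. p v) = (\<Sum>v\<in>V. p' v) + m * card {v \<in> V. m \<le> p v}"
      unfolding ind[symmetric] by (simp add: sum.distrib[symmetric])
    \<comment> \<open>Only an inequality holds for \<open>q\<close>: points with \<open>q\<close>
      strictly between 0 and \<open>m\<close> contribute nothing to the right-hand side.\<close>
    moreover have "(\<Sum>v\<in>V. q v) \<ge> (\<Sum>v\<in>V. q' v) + m * card {v \<in> V. m \<le> q v}"
      unfolding ind[symmetric] sum.distrib[symmetric]
      using less.prems(2) by (intro sum_mono) (auto simp: q'_def)
    moreover have "m * (real k * card {v \<in> V. m \<le> p v}) \<le> m * card {v \<in> V. m \<le> q v}"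
    proof -
      have "real (k * card {v \<in> V. m \<le> p v}) \<le> real (card {v \<in> V. m \<le> q v})"
        using less.prems(3)[OF m0] by (rule of_nat_mono)
      then show ?thesis using m0 by (simp add: mult_left_mono)
    qed
    ultimately show ?thesis using IH by (simp add: algebra_simps)
  qed
qed

text \<open>The matching equations are the first alternative of Farkas' lemma. Under the second, a
  \<open>T\<close> through a vertex of \<open>A\<close> avoiding \<open>W\<close> would have weight
  below \<open>-s + (t - 1) * (s / (t - 1)) = 0\<close>; this is why \<open>W\<close> has threshold
  \<open>s / (t - 1)\<close>.\<close>

lemma fractional_perfect_matching_of_expansion:
  fixes C :: "'a set set"
  assumes V: "finite V" and C: "\<And>T. T \<in> C \<Longrightarrow> T \<subseteq> V \<and> card T = t" and t: "2 \<le> t"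
    and expand: "\<And>A W. A \<subseteq> V \<Longrightarrow> W \<subseteq> V \<Longrightarrow> A \<noteq> {} \<Longrightarrow> A \<inter> W = {} \<Longrightarrow>
      card W < (t - 1) * card A \<Longrightarrow> \<exists>T\<in>C. T \<inter> A \<noteq> {} \<and> T \<inter> W = {}"
  obtains c where "\<And>T. T \<in> C \<Longrightarrow> 0 \<le> (c T :: real)"
    and "\<And>v. v \<in> V \<Longrightarrow> (\<Sum>T\<in>{T \<in> C. v \<in> T}. c T) = 1"
proof -
  have finC: "finite C" using V C by (intro finite_subset[of C "Pow V"]) auto
  consider (comb) c where "\<forall>T\<in>C. 0 \<le> (c T :: real)"
      "\<forall>v\<in>V. 1 = (\<Sum>T\<in>C. c T * (if v \<in> T then 1 else 0))"
    | (sep) x where "\<forall>T\<in>C. 0 \<le> (\<Sum>v\<in>V. (if v \<in> T then 1 else 0) * (x v :: real))" "(\<Sum>v\<in>V. 1 * x v) < 0"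
    using farkas[OF finC V, of "\<lambda>_. 1" "\<lambda>T v. if v \<in> T then 1 else 0"] by blast
  then show ?thesis
  proof cases
    case comb
    have "(\<Sum>T\<in>{T \<in> C. v \<in> T}. c T) = (\<Sum>T\<in>C. c T * (if v \<in> T then 1 else 0))" for v
      using finC by (simp add: sum.inter_filter if_distrib cong: if_cong)
    then show ?thesis using comb that[of c] by auto
  next
    case sep
    have sumT: "0 \<le> (\<Sum>v\<in>T. x v)" if "T \<in> C" for T
    proof -
      have "(\<Sum>v\<in>V. (if v \<in> T then 1 else 0) * x v) = (\<Sum>v\<in>V. if v \<in> T then x v else 0)"
        by (intro sum.cong) auto
      also have "\<dots> = (\<Sum>v\<in>T. x v)"
        using V C[OF that] by (simp add: sum.inter_restrict[symmetric] Int_absorb1)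
      finally show ?thesis using sep(1) that by auto
    qed
    have "real (t - 1) * (\<Sum>v\<in>V. max 0 (- x v)) \<le> (\<Sum>v\<in>V. max 0 (real (t - 1) * x v))"
    proof (rule sum_le_of_card_superlevel_le[OF V])
      fix s :: real assume s: "0 < s"
      define A where "A = {v \<in> V. s \<le> max 0 (- x v)}"
      define W where "W = {v \<in> V. s \<le> max 0 (real (t - 1) * x v)}"
      have disj: "A \<inter> W = {}"
      proof -
        have "real (t - 1) * x v < s" if "s \<le> - x v" for v
          using that s t mult_pos_neg[of "real (t - 1)" "x v"] by simp
        then show ?thesis using s by (force simp: A_def W_def le_max_iff_disj)
      qed
      show "(t - 1) * card {v \<in> V. s \<le> max 0 (- x v)} \<le> card {v \<in> V. s \<le> max 0 (real (t - 1) * x v)}"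
      proof (rule ccontr)
        assume "\<not> ?thesis"
        then have less: "card W < (t - 1) * card A" unfolding A_def W_def by linarith
        then have "A \<noteq> {}" by auto
        moreover have "A \<subseteq> V" "W \<subseteq> V" by (auto simp: A_def W_def)
        ultimately obtain T u where T: "T \<in> C" "T \<inter> W = {}" "u \<in> T" "u \<in> A"
          using expand[of A W] less disj by blast
        have finT: "finite T" and cardT: "card (T - {u}) = t - 1" and TV: "T \<subseteq> V"
          using C[OF T(1)] V T(3) finite_subset by auto
        have "T - {u} \<noteq> {}" using cardT t by (cases "T - {u} = {}") (simp_all del: Diff_eq_empty_iff)
        then have "(\<Sum>v\<in>T - {u}. real (t - 1) * x v) < (\<Sum>v\<in>T - {u}. s)"
          using finT T(2) TV by (intro sum_strict_mono) (force simp: W_def not_le[symmetric] simp del: of_nat_diff)+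
        then have "real (t - 1) * (\<Sum>v\<in>T - {u}. x v) < real (t - 1) * s"
          using cardT by (simp add: sum_distrib_left)
        then have "(\<Sum>v\<in>T - {u}. x v) < s"
          using t by (simp add: mult_less_cancel_left)
        moreover have "x u \<le> - s" using T(4) s by (auto simp: A_def)
        ultimately have "(\<Sum>v\<in>T. x v) < 0" using finT T(3) by (simp add: sum.remove)
        then show False using sumT[OF T(1)] by simp
      qed
    qed auto
    also have "\<dots> = real (t - 1) * (\<Sum>v\<in>V. max 0 (x v))"
      unfolding sum_distrib_left by (intro sum.cong) (auto simp: max_def mult_le_0_iff zero_le_mult_iff)
    finally have "(\<Sum>v\<in>V. max 0 (- x v)) \<le> (\<Sum>v\<in>V. max 0 (x v))"
      using t by simp
    then have "0 \<le> (\<Sum>v\<in>V. max 0 (x v) - max 0 (- x v))" by (simp add: sum_subtractf)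
    also have "\<dots> = (\<Sum>v\<in>V. x v)" by (intro sum.cong) auto
    finally show ?thesis using sep(2) by simp
  qed
qed


section \<open>Packing fractional factors with bounded edge load\<close>

lemma finite_clique_copies: "finite (clique_copies t n E)"
  by (rule finite_subset[of _ "Pow {..<n}"]) (auto simp: clique_copies_def)

lemma clique_copies_mono:
  "(\<And>u v. E' u v \<Longrightarrow> E u v) \<Longrightarrow> clique_copies t n E' \<subseteq> clique_copies t n E"
  by (auto simp: clique_copies_def)

text \<open>Double counting of pairs of a vertex in \<open>S\<close> and a clique containing it and
  \<open>u\<close>: a clique through \<open>u\<close> has only \<open>t - 1\<close> other
  vertices.\<close>

lemma card_overloaded_le:
  fixes g :: "nat set \<Rightarrow> real"
  assumes g: "\<And>T. T \<in> clique_copies t n E \<Longrightarrow> 0 \<le> g T"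
    and S: "finite S" "u \<notin> S"
      "\<And>v. v \<in> S \<Longrightarrow> 1 < (\<Sum>T\<in>{T \<in> clique_copies t n E. {u, v} \<subseteq> T}. g T)"
  shows "card S \<le> real (t - 1) * (\<Sum>T\<in>{T \<in> clique_copies t n E. u \<in> T}. g T)"
proof -
  let ?K = "clique_copies t n E"
  have "real (card S) \<le> (\<Sum>v\<in>S. \<Sum>T\<in>{T \<in> ?K. {u, v} \<subseteq> T}. g T)"
    using sum_mono[of S "\<lambda>_. 1" "\<lambda>v. \<Sum>T\<in>{T \<in> ?K. {u, v} \<subseteq> T}. g T"] S(3) by force
  also have "\<dots> = (\<Sum>v\<in>S. \<Sum>T\<in>{T \<in> ?K. u \<in> T}. if v \<in> T then g T else 0)"
  proof (rule sum.cong[OF refl])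
    fix v
    have "{T \<in> ?K. {u, v} \<subseteq> T} = {T \<in> {T \<in> ?K. u \<in> T}. v \<in> T}" by auto
    then show "(\<Sum>T\<in>{T \<in> ?K. {u, v} \<subseteq> T}. g T) = (\<Sum>T\<in>{T \<in> ?K. u \<in> T}. if v \<in> T then g T else 0)"
      by (simp only:) (rule sum.inter_filter, simp add: finite_clique_copies)
  qed
  also have "\<dots> = (\<Sum>T\<in>{T \<in> ?K. u \<in> T}. \<Sum>v\<in>S. if v \<in> T then g T else 0)"
    by (rule sum.swap)
  also have "\<dots> \<le> (\<Sum>T\<in>{T \<in> ?K. u \<in> T}. real (t - 1) * g T)"
  proof (rule sum_mono)
    fix T assume T: "T \<in> {T \<in> ?K. u \<in> T}"
    then have finT: "finite T" and "card (T - {u}) = t - 1"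
      by (auto simp: clique_copies_def intro: finite_subset)
    moreover have "card (S \<inter> T) \<le> card (T - {u})"
      using S(2) finT by (intro card_mono) auto
    ultimately have "real (card (S \<inter> T)) \<le> real (t - 1)" by simp
    moreover have "(\<Sum>v\<in>S. if v \<in> T then g T else 0) = real (card (S \<inter> T)) * g T"
      using S(1) by (simp add: sum.inter_restrict[symmetric])
    ultimately show "(\<Sum>v\<in>S. if v \<in> T then g T else 0) \<le> real (t - 1) * g T"
      using g T by (auto intro: mult_right_mono)
  qed
  finally show ?thesis by (simp add: sum_distrib_left)
qed

text \<open>Greedy choice, by induction on \<open>k\<close>. Edges of load above 1 are deleted
  before the next factor is chosen, so an edge gains at most 1 while its load is at most 1 and
  nothing afterwards. By \<open>card_overloaded_le\<close> a vertex has lost at most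
  \<open>k * (t - 1)\<close> edges after \<open>k\<close> factors.\<close>

lemma low_load_packing:
  assumes G: "simple_graph n E"
    and factor: "\<And>E'. (\<And>u v. E' u v \<Longrightarrow> E u v) \<Longrightarrow> (\<And>u v. E' u v \<Longrightarrow> E' v u) \<Longrightarrow>
      (\<And>u. u < n \<Longrightarrow> card {v. E u v \<and> \<not> E' u v} \<le> r) \<Longrightarrow>
      \<exists>c. (\<forall>T\<in>clique_copies t n E'. 0 \<le> (c T :: real)) \<and>
          (\<forall>v<n. (\<Sum>T\<in>{T \<in> clique_copies t n E'. v \<in> T}. c T) = 1)"
    and "k * (t - 1) \<le> r"
  shows "\<exists>g. (\<forall>T\<in>clique_copies t n E. 0 \<le> (g T :: real)) \<and>
      (\<forall>v<n. (\<Sum>T\<in>{T \<in> clique_copies t n E. v \<in> T}. g T) = k) \<and>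
      (\<forall>u v. E u v \<longrightarrow> (\<Sum>T\<in>{T \<in> clique_copies t n E. {u, v} \<subseteq> T}. g T) \<le> 2)"
  using assms(3)
proof (induction k)
  case 0
  show ?case by (rule exI[of _ "\<lambda>_. 0"]) simp
next
  case (Suc k)
  let ?K = "clique_copies t n E"
  define load where "load = (\<lambda>(g :: nat set \<Rightarrow> real) u v. \<Sum>T\<in>{T \<in> ?K. {u, v} \<subseteq> T}. g T)"
  from Suc obtain g where g: "\<forall>T\<in>?K. 0 \<le> g T"
      "\<forall>v<n. (\<Sum>T\<in>{T \<in> ?K. v \<in> T}. g T) = real k" "\<forall>u v. E u v \<longrightarrow> load g u v \<le> 2"
    unfolding load_def by auto
  define E' where "E' = (\<lambda>u v. E u v \<and> load g u v \<le> 1)"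
  let ?K' = "clique_copies t n E'"
  have E'E: "E' u v \<Longrightarrow> E u v" for u v by (simp add: E'_def)
  have K'K: "?K' \<subseteq> ?K" by (rule clique_copies_mono) (rule E'E)
  have "\<exists>c. (\<forall>T\<in>?K'. 0 \<le> (c T :: real)) \<and> (\<forall>v<n. (\<Sum>T\<in>{T \<in> ?K'. v \<in> T}. c T) = 1)"
  proof (rule factor)
    show "E' u v \<Longrightarrow> E u v" for u v by (rule E'E)
    show "E' v u" if "E' u v" for u v
      using that G unfolding E'_def load_def simple_graph_def by (metis insert_commute)
    fix u assume u: "u < n"
    define S where "S = {v. E u v \<and> \<not> E' u v}"
    have "S \<subseteq> {..<n}" and "u \<notin> S" using G by (auto simp: S_def simple_graph_def)
    then have "finite S" "u \<notin> S" using finite_subset by blast+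
    moreover have "1 < load g u v" if "v \<in> S" for v using that by (auto simp: S_def E'_def)
    ultimately have "card S \<le> real (t - 1) * (\<Sum>T\<in>{T \<in> ?K. u \<in> T}. g T)"
      using g(1) unfolding load_def by (intro card_overloaded_le) auto
    also have "\<dots> = real (k * (t - 1))" using g(2) u by simp
    finally have "card S \<le> k * (t - 1)" by (simp only: of_nat_le_iff)
    then show "card {v. E u v \<and> \<not> E' u v} \<le> r" using Suc.prems by (simp add: S_def)
  qed
  then obtain c where c: "\<forall>T\<in>?K'. 0 \<le> (c T :: real)"
      "\<forall>v<n. (\<Sum>T\<in>{T \<in> ?K'. v \<in> T}. c T) = 1" by blast
  define h where "h = (\<lambda>T. if T \<in> ?K' then c T else 0)"
  have h0: "\<forall>T\<in>?K. 0 \<le> h T" using c(1) by (simp add: h_def)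
  have h1: "(\<Sum>T\<in>{T \<in> ?K. v \<in> T}. h T) = 1" if "v < n" for v
  proof -
    have "(\<Sum>T\<in>{T \<in> ?K. v \<in> T}. h T) = (\<Sum>T\<in>{T \<in> ?K'. v \<in> T}. c T)"
      using K'K finite_clique_copies[of t n E] by (intro sum.mono_neutral_cong_right) (auto simp: h_def)
    then show ?thesis using c(2) that by simp
  qed
  \<comment> \<open>A surviving edge receives at most the new weight at its endpoint
    \<open>u\<close>, which is 1; a deleted edge lies in no clique of \<open>E'\<close>.\<close>
  have load_h: "load h u v \<le> (if E' u v then 1 else 0)" if "E u v" for u v
  proof (cases "E' u v")
    case True
    have "load h u v \<le> (\<Sum>T\<in>{T \<in> ?K. u \<in> T}. h T)"
      unfolding load_def using h0 finite_clique_copies[of t n E] by (intro sum_mono2) auto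
    then show ?thesis using True h1[of u] that G by (simp add: simple_graph_def)
  next
    case False
    have "u \<noteq> v" using that G by (auto simp: simple_graph_def)
    then have "h T = 0" if "{u, v} \<subseteq> T" for T
      using False that by (auto simp: h_def clique_copies_def)
    then show ?thesis using False by (simp add: load_def)
  qed
  have "load (\<lambda>T. g T + h T) u v \<le> 2" if "E u v" for u v
  proof -
    have "load (\<lambda>T. g T + h T) u v = load g u v + load h u v"
      by (simp add: load_def sum.distrib)
    then show ?thesis using load_h[OF that] g(3) that by (fastforce simp: E'_def split: if_splits)
  qed
  then show ?case
    using g h0 h1 unfolding load_def
    by (intro exI[of _ "\<lambda>T. g T + h T"]) (simp add: sum.distrib)
qed

section \<open>Cliques from expander mixing\<close>

text \<open>A clique is grown by passing repeatedly to a neighbourhood. Since \<kappa> is at most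
  \<open>card U * q\<close> with \<open>q = d / (2 * n)\<close>, the average degree inside
  \<open>U\<close> is at least \<open>2 * card U * q\<close> minus \<kappa>, hence at least
  \<open>card U * q\<close>. Each new vertex thus costs one factor \<open>q\<close>, and
  \<open>Suc s\<close> vertices cost \<open>s\<close> factors.\<close>

lemma clique_of_density:
  fixes \<kappa> :: real
  assumes nd: "0 < d" "d \<le> n" and \<kappa>: "0 < \<kappa>"
    and sym: "\<And>u v. E u v \<Longrightarrow> E v u"
    and dense: "\<And>U. U \<subseteq> {..<n} \<Longrightarrow>
      real d * (real (card U))\<^sup>2 / real n - \<kappa> * card U \<le> (\<Sum>u\<in>U. real (card {v \<in> U. E u v}))"
    and irr: "\<And>u. \<not> E u u"
    and U: "U \<subseteq> {..<n}" "\<kappa> \<le> card U * (real d / (2 * real n)) ^ s"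
  shows "\<exists>T\<in>clique_copies (Suc s) n E. T \<subseteq> U"
  using U
proof (induction s arbitrary: U)
  case 0
  then obtain u where "u \<in> U" using \<kappa> by fastforce
  then have "{u} \<in> clique_copies (Suc 0) n E" "{u} \<subseteq> U" using 0 by (auto simp: clique_copies_def)
  then show ?case by blast
next
  case (Suc s)
  define q where "q = real d / (2 * real n)"
  have q: "0 < q" "q \<le> 1" using nd by (auto simp: q_def)
  have finU: "finite U" using Suc.prems(1) finite_subset by blast
  have "\<kappa> \<le> card U * (q * q ^ s)" using Suc.prems(2) by (simp add: q_def)
  also have "\<dots> \<le> card U * (q * 1)"
    using q by (intro mult_left_mono) (auto simp: power_le_one)
  finally have \<kappa>q: "\<kappa> \<le> card U * q" by simp
  then have U0: "U \<noteq> {}" using \<kappa> by auto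
  have "\<exists>u\<in>U. card U * q \<le> card {v \<in> U. E u v}"
  proof (rule ccontr)
    assume "\<not> ?thesis"
    then have "(\<Sum>u\<in>U. real (card {v \<in> U. E u v})) < (\<Sum>u\<in>U. card U * q)"
      using finU U0 by (intro sum_strict_mono) auto
    also have "\<dots> = card U * (card U * q)" by simp
    also have "\<dots> \<le> card U * (2 * (card U * q) - \<kappa>)"
      using \<kappa>q by (intro mult_left_mono) linarith+
    also have "\<dots> = real d * (real (card U))\<^sup>2 / real n - \<kappa> * card U"
      using nd by (simp add: q_def field_simps power2_eq_square)
    finally show False using dense[OF Suc.prems(1)] by simp
  qed
  then obtain u where u: "u \<in> U" "card U * q \<le> card {v \<in> U. E u v}" by blast
  have "\<kappa> \<le> card U * q * q ^ s" using Suc.prems(2) by (simp add: q_def)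
  also have "\<dots> \<le> card {v \<in> U. E u v} * q ^ s"
    using u(2) q by (intro mult_right_mono) auto
  finally obtain T where T: "T \<in> clique_copies (Suc s) n E" "T \<subseteq> {v \<in> U. E u v}"
    using Suc.IH[of "{v \<in> U. E u v}"] Suc.prems(1) unfolding q_def by auto
  have "u \<notin> T" using T(2) irr by auto
  moreover have "finite T" using T(2) finU finite_subset[of T U] by auto
  ultimately have "insert u T \<in> clique_copies (Suc (Suc s)) n E"
    using T u(1) Suc.prems(1) sym by (auto simp: clique_copies_def)
  then show ?case using u(1) T(2) by (intro bexI[of _ "insert u T"]) auto
qed

text \<open>If \<open>A\<close> has at least \<open>n / (4 * t)\<close> vertices, it contains a
  whole \<open>K_t\<close>. Otherwise \<open>W\<close> has fewer than \<open>n / 4\<close> vertices,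
  so some \<open>u\<close> in \<open>A\<close> has few neighbours in \<open>W\<close>, and its
  remaining neighbourhood contains a \<open>K_(t-1)\<close> that \<open>u\<close> completes.\<close>

lemma clique_expansion:
  fixes lam :: real
  assumes nd: "0 < d" "d \<le> n" and t: "3 \<le> t"
    and lam: "0 < lam" "lam \<le> 1 / (50 * real t * 4 ^ (t - 2)) * (real d ^ (t - 1) / real n ^ (t - 2))"
    and G: "simple_graph n E" "regular_graph n d E"
    and mixing: "\<And>S T. S \<subseteq> {..<n} \<Longrightarrow> T \<subseteq> {..<n} \<Longrightarrow>
      \<bar>(\<Sum>u\<in>S. real (card {v \<in> T. E u v})) - real d * card S * card T / real n\<bar>
        \<le> lam * sqrt (real (card S) * real (card T))"
    and E': "\<And>u v. E' u v \<Longrightarrow> E u v" "\<And>u v. E' u v \<Longrightarrow> E' v u"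
    and removed: "\<And>u. u < n \<Longrightarrow> real (card {v. E u v \<and> \<not> E' u v}) \<le> lam"
    and A: "A \<subseteq> {..<n}" "A \<noteq> {}" and W: "W \<subseteq> {..<n}" "A \<inter> W = {}"
      "card W < (t - 1) * card A"
  shows "\<exists>T\<in>clique_copies t n E'. T \<inter> A \<noteq> {} \<and> T \<inter> W = {}"
proof -
  have edge: "u < n" "v < n" "u \<noteq> v" if "E u v" for u v
    using that G(1) by (auto simp: simple_graph_def)
  have fin: "finite {v. E u v}" for u
    by (rule finite_subset[of _ "{..<n}"]) (auto dest: edge)
  have deg: "card {v. E u v} = d" if "u < n" for u
  proof -
    have "{v. E u v} = {v. v < n \<and> E u v}" by (auto dest: edge)
    then show ?thesis using G(2) that by (simp add: regular_graph_def)
  qed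
  \<comment> \<open>One \<open>lam\<close> is the mixing error, the other pays for the edges removed
    at each vertex.\<close>
  have dense: "real d * (real (card U))\<^sup>2 / real n - (2 * lam) * card U
      \<le> (\<Sum>u\<in>U. real (card {v \<in> U. E' u v}))" if U: "U \<subseteq> {..<n}" for U
  proof -
    have finU: "finite U" using U finite_subset by blast
    have "real d * (real (card U))\<^sup>2 / real n - lam * card U \<le> (\<Sum>u\<in>U. real (card {v \<in> U. E u v}))"
      using mixing[OF U U] by (simp add: power2_eq_square abs_le_iff mult.assoc)
    also have "\<dots> \<le> (\<Sum>u\<in>U. real (card {v \<in> U. E' u v}) + lam)"
    proof (rule sum_mono)
      fix u assume u: "u \<in> U"
      have "card {v \<in> U. E u v} \<le> card ({v \<in> U. E' u v} \<union> {v. E u v \<and> \<not> E' u v})"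
        using finU fin[of u] by (intro card_mono) auto
      also have "\<dots> \<le> card {v \<in> U. E' u v} + card {v. E u v \<and> \<not> E' u v}" by (rule card_Un_le)
      finally show "real (card {v \<in> U. E u v}) \<le> real (card {v \<in> U. E' u v}) + lam"
        using removed[of u] u U by force
    qed
    finally show ?thesis by (simp add: sum.distrib algebra_simps)
  qed
  have clique: "\<exists>T\<in>clique_copies (Suc s) n E'. T \<subseteq> U"
    if "U \<subseteq> {..<n}" "2 * lam \<le> card U * (real d / (2 * real n)) ^ s" for U s
  proof (rule clique_of_density[of d n "2 * lam" E' U s])
    show "\<not> E' u u" for u using E'(1) edge(3) by blast
  qed (use that nd lam(1) E'(2) dense in auto)
  obtain s where s: "t = s + 3" using t by (metis add.commute le_Suc_ex)
  define q where "q = real d / (2 * real n)"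
  have q: "0 < q" "q \<le> 1 / 2" using nd by (auto simp: q_def field_simps)
  \<comment> \<open>With \<open>d / n = 2 * q\<close>, the power of 4 in the hypothesis cancels the
    resulting power of 2 and leaves a spare \<open>2 ^ (s + 1)\<close>, which is at least 2.\<close>
  have "4 * lam \<le> 4 * (1 / (50 * real t * 4 ^ (t - 2)) * (real d ^ (t - 1) / real n ^ (t - 2)))"
    using lam(2) by (rule mult_left_mono) simp
  also have "\<dots> = 2 * d * q ^ (s + 1) / (25 * real t * 2 ^ (s + 1))"
  proof -
    have "(4::real) ^ (s + 1) = 2 ^ (s + 1) * 2 ^ (s + 1)"
      by (simp add: power_mult_distrib[symmetric])
    moreover have "t - 2 = s + 1" "t - 1 = s + 2" using s by auto
    ultimately show ?thesis using nd t by (simp add: q_def power_divide field_simps)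
  qed
  also have "\<dots> \<le> 2 * d * q ^ (s + 1) / (25 * real t * 2)"
    using q t by (intro divide_left_mono mult_left_mono) auto
  finally have lam4: "4 * lam \<le> d * q ^ (s + 1) / (25 * real t)" by (simp add: mult.left_commute)
  show ?thesis
  proof (cases "real n \<le> 4 * real t * card A")
    case True
    have "2 * lam \<le> d * q ^ (s + 1) / (50 * real t)" using lam4 by simp
    also have "\<dots> \<le> d * q ^ (s + 1) / (8 * real t)"
      using q t by (intro divide_left_mono) auto
    \<comment> \<open>The factor \<open>d = 2 * n * q\<close> supplies the last power of
      \<open>q\<close> and exactly the size \<open>n / (4 * t)\<close> of this case.\<close>
    also have "\<dots> = n / (4 * real t) * q ^ (s + 2)" using nd by (simp add: q_def)
    also have "\<dots> \<le> card A * q ^ (s + 2)"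
      using True t q by (intro mult_right_mono) (auto simp: field_simps)
    finally obtain T where "T \<in> clique_copies (Suc (s + 2)) n E'" "T \<subseteq> A"
      using clique[OF A(1)] unfolding q_def by blast
    moreover from this have "T \<noteq> {}" by (auto simp: clique_copies_def)
    moreover have "Suc (s + 2) = t" using s by simp
    ultimately show ?thesis using W(2) by (intro bexI[of _ T]) auto
  next
    case False
    define a where "a = card A"
    have a0: "0 < a" using A finite_subset[of A "{..<n}"] by (auto simp: a_def card_gt_0_iff)
    have Wa: "real (card W) \<le> real t * a"
    proof -
      have "card W \<le> t * a" using W(3) unfolding a_def
        by (meson diff_le_self le_trans less_imp_le mult_le_mono1)
      then show ?thesis by (metis of_nat_le_iff of_nat_mult)
    qed
    have lamd: "lam \<le> d / (100 * real t)"
    proof -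
      have "q ^ (s + 1) \<le> 1" using q by (intro power_le_one) auto
      then have "real d * q ^ (s + 1) \<le> real d * 1" by (rule mult_left_mono) simp
      then have "d * q ^ (s + 1) / (25 * real t) \<le> real d * 1 / (25 * real t)"
        by (rule divide_right_mono) simp
      then show ?thesis using lam4 by simp
    qed
    \<comment> \<open>Averaging over \<open>A\<close>: otherwise the edges from \<open>A\<close> to
      \<open>W\<close> would exceed the mixing bound, whose main term is at most
      \<open>a * d / 4\<close> and whose error is at most \<open>lam * a * t\<close>.\<close>
    have "\<exists>u\<in>A. card {v \<in> W. E u v} \<le> d / 4 + lam * real t"
    proof (rule ccontr)
      assume "\<not> ?thesis"
      then have "(\<Sum>u\<in>A. d / 4 + lam * real t) < (\<Sum>u\<in>A. real (card {v \<in> W. E u v}))"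
        using A finite_subset[of A "{..<n}"] by (intro sum_strict_mono) force+
      also have "\<dots> \<le> real d * a * card W / real n + lam * sqrt (real a * real (card W))"
        using mixing[OF A(1) W(1)] by (simp add: a_def abs_le_iff)
      also have "\<dots> \<le> real d * a * (real t * a) / real n + lam * sqrt (real a * (real t * a))"
        using Wa lam nd
        by (intro add_mono mult_left_mono divide_right_mono real_sqrt_le_mono) auto
      also have "real d * a * (real t * a) / real n \<le> a * (d / 4)"
      proof -
        have "real t * a / real n \<le> 1 / 4" using False nd by (simp add: field_simps a_def)
        then have "(real d * a) * (real t * a / real n) \<le> (real d * a) * (1 / 4)"
          by (intro mult_left_mono) auto
        then show ?thesis by (simp add: mult_ac)
      qed
      also have "sqrt (real a * (real t * a)) \<le> a * real t"
        using t by (intro real_le_lsqrt) (auto simp: power2_eq_square algebra_simps mult_le_cancel_left1 intro!: mult_left_mono)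
      finally show False using lam(1) by (simp add: a_def algebra_simps)
    qed
    then obtain u where u: "u \<in> A" "card {v \<in> W. E u v} \<le> d / 4 + lam * real t" by blast
    have un: "u < n" using u A by auto
    define B where "B = {v. E' u v} - W"
    have Bsub: "B \<subseteq> {..<n}" using E'(1) edge(2) unfolding B_def by blast
    \<comment> \<open>The \<open>d\<close> neighbours of \<open>u\<close> split into
      \<open>B\<close>, those in \<open>W\<close> and those lost with removed edges; the last two
      kinds together number at most \<open>d / 2\<close>.\<close>
    have "card {v. E u v} \<le> card (B \<union> {v \<in> W. E u v} \<union> {v. E u v \<and> \<not> E' u v})"
      using fin[of u] Bsub finite_subset[of B "{..<n}"] by (intro card_mono) (auto simp: B_def)
    also have "\<dots> \<le> card B + card {v \<in> W. E u v} + card {v. E u v \<and> \<not> E' u v}"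
      by (meson add_le_mono card_Un_le le_refl le_trans)
    finally have "real d \<le> card B + card {v \<in> W. E u v} + card {v. E u v \<and> \<not> E' u v}"
      using deg[OF un] by (metis of_nat_add of_nat_le_iff)
    also have "\<dots> \<le> card B + (d / 4 + lam * real t) + lam"
      using u(2) removed[OF un] by simp
    also have "\<dots> \<le> card B + d / 2"
    proof -
      have "lam * real t \<le> d / 100" using lamd t by (simp add: field_simps)
      moreover have "lam \<le> lam * real t" using lam(1) t by simp
      ultimately show ?thesis by simp
    qed
    finally have B: "d / 2 \<le> card B" by simp
    have "d * q ^ (s + 1) / (25 * real t) \<le> d * q ^ (s + 1) / 1"
      using q t by (intro divide_left_mono) auto
    then have "2 * lam \<le> (d / 2) * q ^ (s + 1)" using lam4 by simp
    also have "\<dots> \<le> card B * q ^ (s + 1)" using B q by (intro mult_right_mono) auto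
    finally obtain T where T: "T \<in> clique_copies (Suc (s + 1)) n E'" "T \<subseteq> B"
      using clique[OF Bsub] unfolding q_def by blast
    have "u \<notin> T" using T(2) E'(1) edge(3) unfolding B_def by blast
    moreover have "finite T" using T(2) Bsub finite_subset[of T "{..<n}"] by auto
    ultimately have "insert u T \<in> clique_copies t n E'"
      using T un E'(2) s by (auto simp: clique_copies_def B_def)
    moreover have "insert u T \<inter> W = {}" using T(2) u(1) W(2) by (auto simp: B_def)
    ultimately show ?thesis using u(1) by (intro bexI[of _ "insert u T"]) auto
  qed
qed

section \<open>Spectral gap and mixing\<close>

text \<open>Provides the maximiser for the variational argument. Vectors are functions on all
  naturals, so coordinates from \<open>n\<close> on are fixed at 0 and the others lie in [-1, 1];
  this is a closed subset of a compact product.\<close>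

lemma compact_sum_zero_sphere:
  "compact {x :: nat \<Rightarrow> real. (\<forall>i\<ge>n. x i = 0) \<and> (\<Sum>i<n. x i * x i) = 1 \<and> (\<Sum>i<n. x i) = 0}"
    (is "compact ?K")
proof -
  define B where "B = (\<lambda>i. if i < n then {-1..1::real} else {0})"
  have "compactin (product_topology (\<lambda>_. euclidean) UNIV) (PiE UNIV B)"
    by (subst compactin_PiE) (auto simp: B_def)
  then have "compact (PiE UNIV B)"
    by (metis compactin_euclidean_iff euclidean_product_topology)
  moreover have "closed {x :: nat \<Rightarrow> real. (\<Sum>i<n. x i * x i) = 1}"
    by (intro closed_Collect_eq continuous_intros continuous_on_product_coordinates)
  moreover have "closed {x :: nat \<Rightarrow> real. (\<Sum>i<n. x i) = 0}"
    by (intro closed_Collect_eq continuous_intros continuous_on_product_coordinates)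
  ultimately have "compact (PiE UNIV B \<inter> ({x. (\<Sum>i<n. x i * x i) = 1} \<inter> {x. (\<Sum>i<n. x i) = 0}))"
    by (intro compact_Int_closed closed_Int)
  also have "PiE UNIV B \<inter> ({x. (\<Sum>i<n. x i * x i) = 1} \<inter> {x. (\<Sum>i<n. x i) = 0}) = ?K"
  proof -
    have "(\<forall>i. x i \<in> B i) \<longleftrightarrow> (\<forall>i\<ge>n. x i = 0)" if x: "(\<Sum>i<n. x i * x i) = 1" for x :: "nat \<Rightarrow> real"
    proof (intro iffI allI impI)
      fix i assume "\<forall>i. x i \<in> B i" "n \<le> i"
      then show "x i = 0" by (metis B_def not_less singletonD)
    next
      fix i assume x0: "\<forall>i\<ge>n. x i = 0"
      show "x i \<in> B i"
      proof (cases "i < n")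
        case True
        then have "x i * x i \<le> (\<Sum>i<n. x i * x i)" by (intro member_le_sum) auto
        then have "\<bar>x i\<bar> \<le> 1"
          using x by (simp add: abs_square_le_1[symmetric] power2_eq_square)
        then show ?thesis using True by (simp add: B_def abs_le_iff)
      next
        case False
        then show ?thesis using x0 by (simp add: B_def)
      qed
    qed
    then show ?thesis by (auto simp: PiE_iff)
  qed
  finally show ?thesis .
qed

text \<open>Maximising \<open>\<parallel>a x\<parallel>\<^sup>2\<close> on the unit sphere of the orthogonal complement of the constants gives
  \<open>w\<close> with \<open>a\<^sup>2 w = M w\<close>; then \<open>a w + \<surd>M w\<close>, or \<open>w\<close> itself if that vanishes, is an eigenvector.\<close>

lemma extremal_eigenvector_sum_zero:
  fixes a :: "nat \<Rightarrow> nat \<Rightarrow> real"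
  assumes n: "2 \<le> n" and sym: "\<And>u v. a u v = a v u"
    and rows: "\<And>u. u < n \<Longrightarrow> (\<Sum>v<n. a u v) = d"
  obtains w \<rho> where "(\<Sum>u<n. w u) = 0" "\<exists>u<n. w u \<noteq> 0"
    "\<forall>u<n. (\<Sum>v<n. a u v * w v) = \<rho> * w u"
    "\<forall>x. (\<Sum>u<n. x u) = 0 \<longrightarrow> (\<Sum>u<n. (\<Sum>v<n. a u v * x v)\<^sup>2) \<le> \<rho>\<^sup>2 * (\<Sum>u<n. (x u)\<^sup>2)"
proof -
  define ip where "ip = (\<lambda>x y :: nat \<Rightarrow> real. \<Sum>u<n. x u * y u)"
  define ap where "ap = (\<lambda>x u. \<Sum>v<n. a u v * x v)"
  have ip_lin: "ip (\<lambda>u. r * x u + s * y u) z = r * ip x z + s * ip y z" for r s x y z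
    by (simp add: ip_def sum.distrib sum_distrib_left algebra_simps)
  have ip_sym: "ip x y = ip y x" for x y by (simp add: ip_def mult.commute)
  have ap_lin: "ap (\<lambda>u. r * x u + s * y u) = (\<lambda>u. r * ap x u + s * ap y u)" for r s x y
    by (simp add: ap_def sum.distrib sum_distrib_left algebra_simps fun_eq_iff)
  have ap_adj: "ip (ap x) y = ip x (ap y)" for x y
    unfolding ip_def ap_def sum_distrib_left sum_distrib_right
    by (subst sum.swap) (simp add: sym mult_ac)
  have ip_nonneg: "0 \<le> ip x x" for x by (simp add: ip_def sum_nonneg)
  have ip_zero: "x u = 0" if "ip x x = 0" "u < n" for x u
    using that by (simp add: ip_def sum_nonneg_eq_0_iff)
  have ap_sum: "(\<Sum>u<n. ap x u) = d * (\<Sum>u<n. x u)" for x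
  proof -
    have "(\<Sum>u<n. ap x u) = (\<Sum>v<n. \<Sum>u<n. a v u * x v)"
      unfolding ap_def by (subst sum.swap) (simp add: sym)
    also have "\<dots> = (\<Sum>v<n. d * x v)" by (simp add: sum_distrib_right[symmetric] rows)
    finally show ?thesis by (simp add: sum_distrib_left)
  qed
  define K where "K = {x :: nat \<Rightarrow> real. (\<forall>i\<ge>n. x i = 0) \<and> (\<Sum>i<n. x i * x i) = 1 \<and> (\<Sum>i<n. x i) = 0}"
  \<comment> \<open>Nonemptiness of the sphere, the place where two vertices are needed.\<close>
  have "(\<lambda>i. if i = 0 then 1 / sqrt 2 else if i = 1 then - (1 / sqrt 2) else 0) \<in> K"
  proof -
    have "{..<n} = insert 0 (insert 1 {2..<n})" using n by auto
    then show ?thesis using n by (auto simp: K_def)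
  qed
  moreover have "compact K" unfolding K_def by (rule compact_sum_zero_sphere)
  moreover have "continuous_on K (\<lambda>x. ip (ap x) (ap x))"
    unfolding ip_def ap_def
    by (intro continuous_intros continuous_on_subset[OF continuous_on_product_coordinates]) auto
  ultimately obtain w where w: "w \<in> K" "\<And>x. x \<in> K \<Longrightarrow> ip (ap x) (ap x) \<le> ip (ap w) (ap w)"
    using continuous_attains_sup[of K "\<lambda>x. ip (ap x) (ap x)"] by blast
  define M where "M = ip (ap w) (ap w)"
  have w1: "ip w w = 1" and w0: "(\<Sum>u<n. w u) = 0" using w(1) by (auto simp: K_def ip_def)
  have bound: "ip (ap x) (ap x) \<le> M * ip x x" if x: "(\<Sum>u<n. x u) = 0" for x
  proof (cases "ip x x = 0")
    case True
    then have "ap x u = 0" for u using ip_zero[of x] by (simp add: ap_def)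
    then show ?thesis using True by (simp add: ip_def)
  next
    case False
    define r where "r = sqrt (ip x x)"
    have r: "r \<noteq> 0" "r * r = ip x x" using False ip_nonneg[of x] by (auto simp: r_def)
    define y where "y = (\<lambda>u. if u < n then x u / r else 0)"
    have "y \<in> K"
      using x r by (auto simp: K_def y_def ip_def sum_divide_distrib[symmetric])
    then have "ip (ap y) (ap y) \<le> M" using w(2) by (simp add: M_def)
    moreover have "ap y u = ap x u / r" for u by (simp add: ap_def y_def sum_divide_distrib)
    then have "ip (ap y) (ap y) = ip (ap x) (ap x) / ip x x"
      unfolding r(2)[symmetric] by (simp add: ip_def sum_divide_distrib)
    ultimately show ?thesis using False ip_nonneg[of x] by (simp add: divide_le_eq)
  qed
  \<comment> \<open>First-order optimality of \<open>w\<close> in direction \<open>y\<close>. The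
    step \<open>s = - b / (Q + 1)\<close> makes the quadratic \<open>2 * s * b + s^2 * Q\<close>
    negative unless \<open>b = 0\<close>; the added 1 avoids division by zero.\<close>
  have crit: "M * ip w y = ip (ap w) (ap y)" if y: "(\<Sum>u<n. y u) = 0" for y
  proof -
    define Q where "Q = M * ip y y - ip (ap y) (ap y)"
    define b where "b = M * ip w y - ip (ap w) (ap y)"
    define s where "s = - b / (Q + 1)"
    have Q: "0 \<le> Q" using bound[OF y] by (simp add: Q_def)
    have "(\<Sum>u<n. 1 * w u + s * y u) = 0"
      using w0 y by (simp add: sum.distrib sum_distrib_left[symmetric])
    from bound[OF this] have "0 \<le> 2 * s * b + s\<^sup>2 * Q"
      unfolding ap_lin ip_lin ip_sym[of _ "\<lambda>u. 1 * _ u + s * _ u"]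
      by (simp add: w1 M_def[symmetric] Q_def b_def ip_sym[of y w] ip_sym[of "ap y" "ap w"]
          algebra_simps power2_eq_square)
    also have "2 * s * b + s\<^sup>2 * Q = - (b\<^sup>2 * (Q + 2)) / (Q + 1)\<^sup>2"
      using Q by (simp add: s_def field_simps power2_eq_square add_nonneg_eq_0_iff)
    finally have "b\<^sup>2 * (Q + 2) \<le> 0" using Q by (simp add: divide_le_0_iff)
    then show ?thesis using Q by (simp add: b_def mult_le_0_iff)
  qed
  \<comment> \<open>This residual of \<open>a^2 w = M w\<close> itself sums to zero, so it is an
    admissible direction, and by symmetry of \<open>a\<close> the criterion says that it is
    orthogonal to itself.\<close>
  define y where "y = (\<lambda>u. M * w u + (-1) * ap (ap w) u)"
  have "(\<Sum>u<n. y u) = 0"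
    by (simp add: y_def sum_subtractf sum_distrib_left[symmetric] ap_sum w0)
  then have "M * ip w y = ip (ap w) (ap y)" by (rule crit)
  then have "ip y y = 0"
    unfolding y_def ip_lin by (simp add: ap_adj)
  then have sq: "ap (ap w) u = M * w u" if "u < n" for u using ip_zero[of y u] that by (simp add: y_def)
  have M: "0 \<le> M" by (simp add: M_def ip_nonneg)
  have bound': "(\<Sum>u<n. (\<Sum>v<n. a u v * x v)\<^sup>2) \<le> M * (\<Sum>u<n. (x u)\<^sup>2)"
    if "(\<Sum>u<n. x u) = 0" for x
    using bound[OF that] by (simp add: ip_def ap_def power2_eq_square)
  define z where "z = (\<lambda>u. 1 * ap w u + sqrt M * w u)"
  show ?thesis
  proof (cases "\<exists>u<n. z u \<noteq> 0")
    case True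
    have "ap z u = sqrt M * z u" if "u < n" for u
      using sq[OF that] M unfolding z_def ap_lin by (simp add: algebra_simps)
    moreover have "(\<Sum>u<n. z u) = 0"
      by (simp add: z_def sum.distrib sum_distrib_left[symmetric] ap_sum w0)
    ultimately show ?thesis
      using that[of z "sqrt M"] True bound' M by (simp add: ap_def)
  next
    case False
    then have "ap w u = - sqrt M * w u" if "u < n" for u using that by (force simp: z_def)
    moreover have "\<exists>u<n. w u \<noteq> 0"
    proof (rule ccontr)
      assume "\<not> ?thesis"
      then have "ip w w = 0" by (simp add: ip_def)
      then show False using w1 by simp
    qed
    ultimately show ?thesis
      using that[of w "- sqrt M"] w0 bound' M by (simp add: ap_def)
  qed
qed

text \<open>Supplies two entries of the eigenvalue multiset without diagonalising \<open>A\<close>.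
  The nonzero minor on rows \<open>i\<close> and \<open>j\<close> certifies that \<open>x\<close>
  and \<open>y\<close> are independent.\<close>

lemma char_poly_dvd_of_two_eigenvectors:
  fixes A :: "'a :: field mat"
  assumes A: "A \<in> carrier_mat n n" and ij: "i < n" "j < n" "i \<noteq> j" "x i * y j \<noteq> x j * y i"
    and x: "\<And>k. k < n \<Longrightarrow> (\<Sum>m<n. A $$ (k, m) * x m) = \<alpha> * x k"
    and y: "\<And>k. k < n \<Longrightarrow> (\<Sum>m<n. A $$ (k, m) * y m) = \<beta> * y k"
  shows "[:-\<alpha>, 1:] * [:-\<beta>, 1:] dvd char_poly A"
proof -
  \<comment> \<open>With \<open>P\<close> the identity whose columns \<open>i, j\<close> are replaced by \<open>x, y\<close>, the columns \<open>i, j\<close> of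
    \<open>(X I - A) P\<close> are multiples of \<open>X - \<alpha>\<close> and \<open>X - \<beta>\<close>. This counts multiplicity when \<open>\<alpha> = \<beta>\<close>.\<close>
  define P where "P = mat n n (\<lambda>(k, l). if l = i then x k else if l = j then y k else if k = l then 1 else 0)"
  define e where "e = (\<lambda>l. if l = i then [:-\<alpha>, 1:] else if l = j then [:-\<beta>, 1:] else 1)"
  define D where "D = mat n n (\<lambda>(k, l). if k = l then e l else 0)"
  define C where "C = char_poly_matrix A"
  define N where "N = mat n n (\<lambda>(k, l). if l = i then [:x k:] else if l = j then [:y k:] else C $$ (k, l))"
  define P' where "P' = map_mat (\<lambda>c. [:c:]) P"
  have carrier: "P \<in> carrier_mat n n" "D \<in> carrier_mat n n" "N \<in> carrier_mat n n"
      "C \<in> carrier_mat n n" "P' \<in> carrier_mat n n"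
    using A by (auto simp: P_def D_def N_def C_def P'_def)
  have Ce: "C $$ (k, m) = (if k = m then [:0, 1:] else 0) - [:A $$ (k, m):]" if "k < n" "m < n" for k m
    using that A by (simp add: C_def char_poly_matrix_def)
  have eig: "(\<Sum>m<n. C $$ (k, m) * [:z m:]) = [:-\<gamma>, 1:] * [:z k:]"
    if k: "k < n" and z: "(\<Sum>m<n. A $$ (k, m) * z m) = \<gamma> * z k" for k z \<gamma>
  proof -
    have "(\<Sum>m<n. C $$ (k, m) * [:z m:])
        = (\<Sum>m<n. (if k = m then [:0, 1:] * [:z m:] else 0) - [:A $$ (k, m) * z m:])"
      using k by (intro sum.cong) (auto simp: Ce)
    also have "\<dots> = [:0, 1:] * [:z k:] - (\<Sum>m<n. [:A $$ (k, m) * z m:])"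
      using k by (simp add: sum_subtractf)
    also have "(\<Sum>m<n. [:A $$ (k, m) * z m:]) = [:\<Sum>m<n. A $$ (k, m) * z m:]"
      by (induction n) auto
    finally show ?thesis by (simp add: z)
  qed
  have "C * P' = N * D"
  proof (rule eq_matI)
    fix k l assume "k < dim_row (N * D)" "l < dim_col (N * D)"
    then have kl: "k < n" "l < n" using carrier by auto
    have "(C * P') $$ (k, l) = (\<Sum>m<n. C $$ (k, m) * P' $$ (m, l))"
      using kl carrier by (simp add: scalar_prod_def atLeast0LessThan)
    also have "\<dots> = N $$ (k, l) * e l"
    proof -
      consider "l = i" | "l = j" "l \<noteq> i" | "l \<noteq> i" "l \<noteq> j" by blast
      then show ?thesis
      proof cases
        case 1
        then have "(\<Sum>m<n. C $$ (k, m) * P' $$ (m, l)) = (\<Sum>m<n. C $$ (k, m) * [:x m:])"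
          using kl by (intro sum.cong) (auto simp: P'_def P_def)
        also have "\<dots> = [:-\<alpha>, 1:] * [:x k:]" by (rule eig[OF kl(1) x[OF kl(1)]])
        finally show ?thesis using 1 kl by (simp only: N_def e_def) (simp add: mult.commute)
      next
        case 2
        then have "(\<Sum>m<n. C $$ (k, m) * P' $$ (m, l)) = (\<Sum>m<n. C $$ (k, m) * [:y m:])"
          using kl by (intro sum.cong) (auto simp: P'_def P_def)
        also have "\<dots> = [:-\<beta>, 1:] * [:y k:]" by (rule eig[OF kl(1) y[OF kl(1)]])
        finally show ?thesis using 2 kl by (simp only: N_def e_def) (simp add: mult.commute)
      next
        case 3
        then have "(\<Sum>m<n. C $$ (k, m) * P' $$ (m, l)) = (\<Sum>m<n. if m = l then C $$ (k, m) else 0)"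
          using kl by (intro sum.cong) (auto simp: P'_def P_def)
        then show ?thesis using 3 kl by (simp add: N_def e_def)
      qed
    qed
    also have "\<dots> = (\<Sum>m<n. N $$ (k, m) * D $$ (m, l))"
    proof -
      have "(\<Sum>m<n. N $$ (k, m) * D $$ (m, l)) = (\<Sum>m<n. if m = l then N $$ (k, m) * e l else 0)"
        using kl by (intro sum.cong) (auto simp: D_def)
      then show ?thesis using kl by simp
    qed
    also have "\<dots> = (N * D) $$ (k, l)"
      using kl carrier by (simp add: scalar_prod_def atLeast0LessThan)
    finally show "(C * P') $$ (k, l) = (N * D) $$ (k, l)" .
  qed (use carrier in auto)
  \<comment> \<open>Since \<open>det P'\<close> is a nonzero constant, the two linear factors in
    \<open>det D\<close> must divide \<open>char_poly A\<close>.\<close>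
  then have "char_poly A * det P' = det N * det D"
    unfolding char_poly_def C_def[symmetric] using carrier by (metis det_mult)
  moreover have "det D = [:-\<alpha>, 1:] * [:-\<beta>, 1:]"
  proof -
    have "det D = prod_list (diag_mat D)"
      using carrier by (intro det_upper_triangular[of _ n]) (auto simp: upper_triangular_def D_def)
    also have "\<dots> = (\<Prod>l<n. e l)"
    proof -
      have "diag_mat D = map e [0..<n]" using carrier by (auto simp: diag_mat_def D_def)
      then show ?thesis using prod.distinct_set_conv_list[of "[0..<n]" e]
        by (simp add: atLeast0LessThan)
    qed
    also have "\<dots> = (\<Prod>l\<in>{i, j}. e l)"
      using ij by (intro prod.mono_neutral_right) (auto simp: e_def)
    finally show ?thesis using ij by (simp add: e_def)
  qed
  moreover have "det P' = [:det P:]"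
  proof -
    interpret comm_ring_hom "\<lambda>c :: 'a. [:c:]" by unfold_locales auto
    show ?thesis unfolding P'_def by (simp add: hom_det)
  qed
  moreover have "det P \<noteq> 0"
  proof
    assume "det P = 0"
    then obtain v where v: "v \<in> carrier_vec n" "v \<noteq> 0\<^sub>v n" "P *\<^sub>v v = 0\<^sub>v n"
      using det_0_iff_vec_prod_zero_field[OF carrier(1)] by blast
    have row: "x k * v $ i + y k * v $ j + (if k = i \<or> k = j then 0 else v $ k) = 0" if k: "k < n" for k
    proof -
      have "0 = (P *\<^sub>v v) $ k" using v(3) k by simp
      also have "\<dots> = (\<Sum>l<n. P $$ (k, l) * v $ l)"
        using k carrier v(1) by (simp add: scalar_prod_def atLeast0LessThan)
      also have "\<dots> = (\<Sum>l<n. (if l = i then x k * v $ l else 0) + (if l = j then y k * v $ l else 0)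
          + (if l = k then (if k = i \<or> k = j then 0 else v $ l) else 0))"
        using k ij by (intro sum.cong) (auto simp: P_def)
      also have "\<dots> = x k * v $ i + y k * v $ j + (if k = i \<or> k = j then 0 else v $ k)"
        using k ij by (simp add: sum.distrib)
      finally show ?thesis by simp
    qed
    have eqs: "x i * v $ i + y i * v $ j = 0" "x j * v $ i + y j * v $ j = 0"
      using row[of i] row[of j] ij by auto
    \<comment> \<open>Cramer's rule for rows \<open>i\<close> and \<open>j\<close>; once these two
      entries of \<open>v\<close> vanish, every other row reads \<open>v $ k = 0\<close>.\<close>
    have "(x i * y j - x j * y i) * v $ i = y j * (x i * v $ i + y i * v $ j) - y i * (x j * v $ i + y j * v $ j)"
      by (simp add: algebra_simps)
    then have vi: "v $ i = 0" using eqs ij by simp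
    have "(x i * y j - x j * y i) * v $ j = x i * (x j * v $ i + y j * v $ j) - x j * (x i * v $ i + y i * v $ j)"
      by (simp add: algebra_simps)
    then have vj: "v $ j = 0" using eqs ij by simp
    have "v $ k = 0" if "k < n" for k
      using row[OF that] vi vj by (cases "k = i \<or> k = j") auto
    then have "v = 0\<^sub>v n" using v(1) by (intro eq_vecI) auto
    then show False using v(2) by simp
  qed
  ultimately have "char_poly A * [:det P:] = det N * ([:-\<alpha>, 1:] * [:-\<beta>, 1:])" "det P \<noteq> 0" by auto
  moreover have "char_poly A * [:det P:] = Polynomial.smult (det P) (char_poly A)" by simp
  ultimately have "[:-\<alpha>, 1:] * [:-\<beta>, 1:] dvd Polynomial.smult (det P) (char_poly A)" "det P \<noteq> 0"
    by (metis dvd_triv_right)+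
  then show ?thesis by (rule Polynomial.dvd_smult_cancel)
qed

text \<open>By counting: were the entry at index 1 below \<open>min a b\<close>, only the head of
  the decreasing list could reach \<open>min a b\<close>, but two occurrences in the multiset do,
  also when \<open>a = b\<close>.\<close>

lemma second_largest_ge:
  fixes M :: "'a :: linorder multiset"
  assumes "{#a, b#} \<subseteq># M"
  shows "min a b \<le> rev (sorted_list_of_multiset M) ! 1"
proof (rule ccontr)
  assume *: "\<not> ?thesis"
  define xs where "xs = rev (sorted_list_of_multiset M)"
  have xs: "mset xs = M" "sorted_wrt (\<ge>) xs"
    by (auto simp: xs_def sorted_wrt_rev)
  have "2 \<le> length xs"
    using size_mset_mono[OF assms] xs(1) by (metis size_mset size_add_mset size_empty numeral_2_eq_2)
  then obtain p q r where pqr: "xs = p # q # r"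
    by (metis Suc_le_length_iff numeral_2_eq_2)
  have "filter_mset (\<lambda>c. min a b \<le> c) {#a, b#} \<subseteq># filter_mset (\<lambda>c. min a b \<le> c) M"
    by (rule multiset_filter_mono[OF assms])
  then have "{#a, b#} \<subseteq># filter_mset (\<lambda>c. min a b \<le> c) (mset xs)" by (simp add: xs(1))
  also have "filter_mset (\<lambda>c. min a b \<le> c) (mset xs) \<subseteq># {#p#}"
  proof -
    have "\<not> min a b \<le> c" if "c \<in> set (q # r)" for c
      using that xs(2) * pqr unfolding xs_def[symmetric] by auto
    then have "filter_mset (\<lambda>c. min a b \<le> c) (mset (q # r)) = {#}"
      unfolding filter_mset_eq_mempty_iff by simp
    then show ?thesis using pqr by auto
  qed
  finally have "size {#a, b#} \<le> size {#p#}" by (rule size_mset_mono)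
  then show False by simp
qed

text \<open>The extremal eigenvalue \<rho> on the sum-zero vectors and the degree \<open>d\<close>
  are two entries of the spectrum, so the smaller of \<open>d\<close> and the absolute value of
  \<rho> is at most \<open>lam\<close>. As \<open>lam < d\<close>, it must be the latter.\<close>

lemma ndl_graph_contraction:
  assumes G: "ndl_graph n d lam E" and d: "1 \<le> d" "lam < d" and n: "2 \<le> n"
    and x: "(\<Sum>u<n. x u) = (0 :: real)"
  shows "(\<Sum>u<n. (\<Sum>v<n. if E u v then x v else 0)\<^sup>2) \<le> lam\<^sup>2 * (\<Sum>u<n. (x u)\<^sup>2)"
    and "0 \<le> lam"
proof -
  define a where "a = (\<lambda>u v. if E u v then 1 else 0 :: real)"
  have sym: "a u v = a v u" for u v using G by (auto simp: a_def ndl_graph_def simple_graph_def)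
  have rows: "(\<Sum>v<n. a u v) = d" if "u < n" for u
  proof -
    have "{v. v < n \<and> E u v} = {v \<in> {..<n}. E u v}" by auto
    then show ?thesis
      using G that by (simp add: a_def ndl_graph_def regular_graph_def sum.inter_filter[symmetric])
  qed
  obtain w \<rho> where w: "(\<Sum>u<n. w u) = 0" "\<exists>u<n. w u \<noteq> 0"
      "\<forall>u<n. (\<Sum>v<n. a u v * w v) = \<rho> * w u"
      "\<forall>x. (\<Sum>u<n. x u) = 0 \<longrightarrow> (\<Sum>u<n. (\<Sum>v<n. a u v * x v)\<^sup>2) \<le> \<rho>\<^sup>2 * (\<Sum>u<n. (x u)\<^sup>2)"
    using extremal_eigenvector_sum_zero[where a = a, OF n sym rows] by blast
  obtain i where i: "i < n" "w i \<noteq> 0" using w(2) by blast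
  \<comment> \<open>A nonzero vector with sum zero is not constant; \<open>i\<close> and
    \<open>j\<close> then witness its independence from the all-ones vector.\<close>
  have "\<exists>j<n. w j \<noteq> w i"
  proof (rule ccontr)
    assume "\<not> ?thesis"
    then have "(\<Sum>u<n. w u) = real n * w i" by simp
    then show False using w(1) i n by simp
  qed
  then obtain j where j: "j < n" "w j \<noteq> w i" by blast
  define A where "A = adjacency_mat n E"
  have A: "A \<in> carrier_mat n n" by (simp add: A_def adjacency_mat_def)
  have Aa: "A $$ (k, m) = a k m" if "k < n" "m < n" for k m
    using that by (simp add: A_def adjacency_mat_def a_def)
  have "[:- real d, 1:] * [:-\<rho>, 1:] dvd char_poly A"
    using A i j rows w(3)
    by (intro char_poly_dvd_of_two_eigenvectors[of A n i j "\<lambda>_. 1" w]) (auto simp: Aa)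
  then obtain q where q: "char_poly A = [:- real d, 1:] * [:-\<rho>, 1:] * q" by (elim dvdE)
  have "char_poly A \<noteq> 0" using degree_monic_char_poly[OF A] by auto
  then have "q \<noteq> 0" using q by auto
  have "proots (char_poly A) = {#real d#} + {#\<rho>#} + proots q"
  proof -
    have "proots (char_poly A) = proots [:- real d, 1:] + proots [:-\<rho>, 1:] + proots q"
      unfolding q using \<open>q \<noteq> 0\<close> by (simp add: proots_mult del: mult_pCons_left mult_pCons_right)
    then show ?thesis by simp
  qed
  then have "{#\<bar>real d\<bar>, \<bar>\<rho>\<bar>#} \<subseteq># image_mset abs (proots (char_poly A))" by simp
  then have "min \<bar>real d\<bar> \<bar>\<rho>\<bar> \<le> second_abs_eigenvalue n E"
    unfolding second_abs_eigenvalue_def A_def[symmetric] by (rule second_largest_ge)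
  then have \<rho>: "\<bar>\<rho>\<bar> \<le> lam" using G d by (auto simp: ndl_graph_def)
  then show "0 \<le> lam" by simp
  have "(\<Sum>u<n. (\<Sum>v<n. if E u v then x v else 0)\<^sup>2) = (\<Sum>u<n. (\<Sum>v<n. a u v * x v)\<^sup>2)"
    unfolding a_def by (intro sum.cong refl arg_cong2[of _ _ _ _ power]) auto
  also have "\<dots> \<le> \<rho>\<^sup>2 * (\<Sum>u<n. (x u)\<^sup>2)" using w(4) x by blast
  also have "\<dots> \<le> lam\<^sup>2 * (\<Sum>u<n. (x u)\<^sup>2)"
    using \<rho> by (intro mult_right_mono sum_nonneg) (auto simp: abs_le_square_iff[symmetric])
  finally show "(\<Sum>u<n. (\<Sum>v<n. if E u v then x v else 0)\<^sup>2) \<le> lam\<^sup>2 * (\<Sum>u<n. (x u)\<^sup>2)" .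
qed

text \<open>The contraction is applied to the indicator of \<open>T\<close> minus its mean. By
  regularity its image at \<open>u\<close> is the deviation on the left, and its squared norm is
  \<open>card T * (1 - card T / n)\<close>.\<close>

lemma degree_deviation_le:
  assumes G: "ndl_graph n d lam E" and d: "1 \<le> d" "lam < d" and n: "2 \<le> n" and T: "T \<subseteq> {..<n}"
  shows "(\<Sum>u<n. (real (card {v \<in> T. E u v}) - real d * card T / n)\<^sup>2) \<le> lam\<^sup>2 * card T"
proof -
  have finT: "finite T" using T finite_subset by blast
  define m where "m = real (card T) / n"
  define x where "x = (\<lambda>v. (if v \<in> T then 1 else 0) - m)"
  have ind: "(\<Sum>v<n. if v \<in> T then c else 0) = real (card T) * c" for c :: real
    using T by (simp add: sum.inter_restrict[symmetric] Int_absorb1)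
  have nm: "real n * m = card T" using n by (simp add: m_def)
  have x0: "(\<Sum>v<n. x v) = 0" by (simp add: x_def sum_subtractf ind nm del: sum.delta)
  have "(\<Sum>v<n. (x v)\<^sup>2) = (\<Sum>v<n. (if v \<in> T then 1 - 2 * m else 0) + m\<^sup>2)"
    by (intro sum.cong) (auto simp: x_def power2_eq_square algebra_simps)
  also have "\<dots> = card T * (1 - 2 * m) + (real n * m) * m"
    unfolding sum.distrib ind by (simp add: power2_eq_square)
  also have "\<dots> = card T * (1 - m)" unfolding nm by (simp add: algebra_simps)
  also have "\<dots> \<le> real (card T) * 1" by (intro mult_left_mono) (auto simp: m_def)
  finally have x2: "(\<Sum>v<n. (x v)\<^sup>2) \<le> card T" by simp
  have "(\<Sum>v<n. if E u v then x v else 0) = real (card {v \<in> T. E u v}) - real d * card T / n"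
    if "u < n" for u
  proof -
    have "(\<Sum>v<n. if E u v then x v else 0)
        = (\<Sum>v<n. if v \<in> T then if E u v then 1 else 0 else 0) - (\<Sum>v<n. if E u v then m else 0)"
      unfolding sum_subtractf[symmetric] by (intro sum.cong) (auto simp: x_def)
    also have "(\<Sum>v<n. if v \<in> T then if E u v then 1 else 0 else (0::real)) = card {v \<in> T. E u v}"
      using T finT by (simp add: sum.inter_restrict[symmetric] sum.inter_filter[symmetric] Int_absorb1)
    also have "(\<Sum>v<n. if E u v then m else 0) = real d * m"
    proof -
      have "{v \<in> {..<n}. E u v} = {v. v < n \<and> E u v}" by auto
      then show ?thesis
        using G that by (simp add: sum.inter_filter[symmetric] ndl_graph_def regular_graph_def)
    qed
    finally show ?thesis by (simp add: m_def)
  qed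
  then have "(\<Sum>u<n. (real (card {v \<in> T. E u v}) - real d * card T / n)\<^sup>2)
      = (\<Sum>u<n. (\<Sum>v<n. if E u v then x v else 0)\<^sup>2)" by simp
  also have "\<dots> \<le> lam\<^sup>2 * (\<Sum>v<n. (x v)\<^sup>2)"
    by (rule ndl_graph_contraction(1)[OF G d n x0])
  also have "\<dots> \<le> lam\<^sup>2 * card T" using x2 by (intro mult_left_mono) auto
  finally show ?thesis .
qed

text \<open>Cauchy-Schwarz over \<open>S\<close> applied to the degree deviations.\<close>

lemma expander_mixing:
  assumes G: "ndl_graph n d lam E" and d: "1 \<le> d" "lam < d" and n: "2 \<le> n"
    and S: "S \<subseteq> {..<n}" and T: "T \<subseteq> {..<n}"
  shows "\<bar>(\<Sum>u\<in>S. real (card {v \<in> T. E u v})) - real d * card S * card T / n\<bar>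
    \<le> lam * sqrt (real (card S) * real (card T))"
proof -
  define h where "h = (\<lambda>u. real (card {v \<in> T. E u v}) - real d * card T / n)"
  have "(\<Sum>u\<in>S. h u)\<^sup>2 \<le> (\<Sum>u\<in>S. (h u)\<^sup>2) * card S"
    by (rule sum_squared_le_sum_of_squares)
  also have "\<dots> \<le> (\<Sum>u<n. (h u)\<^sup>2) * card S"
    using S by (intro mult_right_mono sum_mono2) auto
  also have "\<dots> \<le> lam\<^sup>2 * card T * card S"
    using degree_deviation_le[OF G d n T] unfolding h_def by (intro mult_right_mono) auto
  finally have "sqrt ((\<Sum>u\<in>S. h u)\<^sup>2) \<le> sqrt (lam\<^sup>2 * (real (card S) * real (card T)))"
    by (intro real_sqrt_le_mono) (simp add: mult_ac)
  then have "\<bar>\<Sum>u\<in>S. h u\<bar> \<le> lam * sqrt (real (card S) * real (card T))"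
    using ndl_graph_contraction(2)[OF G d n, of "\<lambda>_. 0"] by (simp add: real_sqrt_mult)
  moreover have "(\<Sum>u\<in>S. h u) = (\<Sum>u\<in>S. real (card {v \<in> T. E u v})) - real d * card S * card T / n"
    by (simp add: h_def sum_subtractf)
  ultimately show ?thesis by simp
qed

text \<open>For the singleton \<open>T = {0}\<close>, each of the \<open>d\<close> neighbours of 0
  deviates by \<open>1 - d / n\<close>, at least 1/2. This lower bound on \<open>lam\<close> lets it
  absorb the edges deleted during the packing.\<close>

lemma degree_le_eigenvalue_square:
  assumes G: "ndl_graph n d lam E" and d: "1 \<le> d" "lam < d" and n: "2 \<le> n" and dn: "2 * d \<le> n"
  shows "real d \<le> 4 * lam\<^sup>2"
proof -
  have N: "card {u. u < n \<and> E u 0} = d"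
  proof -
    have "{u. u < n \<and> E u 0} = {u. u < n \<and> E 0 u}" using G by (auto simp: ndl_graph_def simple_graph_def)
    then show ?thesis using G n by (simp add: ndl_graph_def regular_graph_def)
  qed
  have "real d / 4 = (\<Sum>u\<in>{u. u < n \<and> E u 0}. (1 / 2)\<^sup>2)" by (simp add: N power2_eq_square)
  also have "\<dots> \<le> (\<Sum>u\<in>{u. u < n \<and> E u 0}. (real (card {v \<in> {0}. E u v}) - real d * card {0::nat} / n)\<^sup>2)"
  proof (rule sum_mono)
    fix u assume u: "u \<in> {u. u < n \<and> E u 0}"
    then have "{v \<in> {0}. E u v} = {0}" by auto
    moreover have "real d / n \<le> 1 / 2" using dn n by (simp add: field_simps)
    ultimately show "(1 / 2)\<^sup>2 \<le> (real (card {v \<in> {0}. E u v}) - real d * card {0::nat} / n)\<^sup>2"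
      by (intro power_mono) auto
  qed
  also have "\<dots> \<le> (\<Sum>u<n. (real (card {v \<in> {0}. E u v}) - real d * card {0::nat} / n)\<^sup>2)"
    by (intro sum_mono2) auto
  also have "\<dots> \<le> lam\<^sup>2 * card {0::nat}" using n by (intro degree_deviation_le[OF G d n]) auto
  finally show ?thesis by simp
qed

section \<open>Growth estimates and assembly\<close>

lemma threshold:
  assumes t: "3 \<le> t" and \<delta>: "0 < \<delta>" "\<delta> < 1 / (2 * real t - 3)"
  obtains n0 :: nat where "\<And>n. n \<ge> n0 \<Longrightarrow> 2 \<le> n" "\<And>n. n \<ge> n0 \<Longrightarrow> 2 * real n powr (1 - \<delta>) \<le> real n"
    "\<And>n. n \<ge> n0 \<Longrightarrow>
      16 * (real (2 * nat \<lceil>real n powr (\<delta> / (4 * (real t)\<^sup>2))\<rceil> * (t - 1))) ^ 3 \<le> real n"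
proof -
  define p where "p = \<delta> / (4 * (real t)\<^sup>2)"
  have "1 / (2 * real t - 3) \<le> 1" using t by (simp add: field_simps)
  then have "\<delta> \<le> 1" using \<delta> by linarith
  moreover have "(3::real)\<^sup>2 \<le> (real t)\<^sup>2" using t by (intro power_mono) auto
  \<comment> \<open>From \<delta> at most 1 and \<open>t\<close> at least 3: the number of factors
    grows at most like \<open>n\<close> to the 1/36, so its cube like \<open>n\<close> to the 1/12.
    The constant 1024 below is 16 times the 64 from cubing \<open>4 * t * y\<close>.\<close>
  ultimately have p: "0 < p" "p \<le> 1 / 36"
    using \<delta> t by (auto simp: p_def field_simps)
  have "\<forall>\<^sub>F n :: nat in sequentially. 2 \<le> n" by (rule eventually_ge_at_top)
  moreover have "\<forall>\<^sub>F n :: nat in sequentially. 2 * real n powr (1 - \<delta>) \<le> real n"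
    using \<delta> by real_asymp
  moreover have "\<forall>\<^sub>F n :: nat in sequentially. 1024 * real t ^ 3 * real n powr (1 / 12) \<le> real n"
    using t by real_asymp
  ultimately have "\<forall>\<^sub>F n :: nat in sequentially. 2 \<le> n \<and> 2 * real n powr (1 - \<delta>) \<le> real n \<and>
      1024 * real t ^ 3 * real n powr (1 / 12) \<le> real n"
    by (intro eventually_conj)
  then obtain n0 where n0: "\<And>n. n \<ge> n0 \<Longrightarrow> 2 \<le> n \<and> 2 * real n powr (1 - \<delta>) \<le> real n \<and>
      1024 * real t ^ 3 * real n powr (1 / 12) \<le> real n"
    by (auto simp: eventually_sequentially)
  have "16 * (real (2 * nat \<lceil>real n powr p\<rceil> * (t - 1))) ^ 3 \<le> real n" if n: "n \<ge> n0" for n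
  proof -
    define y where "y = real n powr (1 / 36)"
    have n2: "2 \<le> n" using n0[OF n] by simp
    have "real n powr p \<le> y" unfolding y_def using n2 p by (intro powr_mono) auto
    moreover have "1 \<le> y" unfolding y_def using n2 by (intro ge_one_powr_ge_zero) auto
    moreover have "real (nat \<lceil>real n powr p\<rceil>) \<le> real n powr p + 1"
    proof -
      have "0 \<le> real n powr p" by simp
      then have "0 \<le> \<lceil>real n powr p\<rceil>" by linarith
      then show ?thesis by (simp add: of_int_ceiling_le_add_one)
    qed
    ultimately have y: "real (nat \<lceil>real n powr p\<rceil>) \<le> 2 * y" "0 \<le> y" by linarith+
    have "16 * (real (2 * m * (t - 1))) ^ 3 \<le> real n" if "real m \<le> 2 * y" for m
    proof -
      have "real (2 * m * (t - 1)) \<le> 2 * (2 * y) * real t"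
        unfolding of_nat_mult using y(2) that by (intro mult_mono) auto
      then have "(real (2 * m * (t - 1))) ^ 3 \<le> (2 * (2 * y) * real t) ^ 3"
        by (intro power_mono) auto
      also have "\<dots> = 64 * real t ^ 3 * y ^ 3" by (simp add: power_mult_distrib)
      also have "y ^ 3 = real n powr (1 / 12)"
        unfolding y_def using n2 by (simp add: powr_power)
      finally show ?thesis using n0[OF n] by simp
    qed
    then show ?thesis using y(1) by blast
  qed
  then show ?thesis using that[of n0] n0 unfolding p_def by blast
qed

text \<open>The condition \<open>d \<ge> 1\<close> excludes the edgeless graph, which meets the
  other hypotheses with \<open>lam = 0\<close> but has no \<open>K_t\<close>. The number of factors
  is rounded up.\<close>

theorem theorem5p1:
  fixes t :: nat and \<delta> :: real
  assumes "t \<ge> 3" and "0 < \<delta>" and "\<delta> < 1 / (2 * real t - 3)"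
  shows "\<exists>n0 :: nat. \<forall>(n :: nat) (d :: nat) (lam :: real) (E :: nat \<Rightarrow> nat \<Rightarrow> bool).
           n \<ge> n0 \<longrightarrow> d \<ge> 1 \<longrightarrow> ndl_graph n d lam E \<longrightarrow>
           real d \<le> real n powr (1 - \<delta>) \<longrightarrow>
           lam \<le> 1 / (50 * real t * 4 ^ (t - 2)) * (real d ^ (t - 1) / real n ^ (t - 2)) \<longrightarrow>
           (\<exists>(l :: nat) (f :: nat \<Rightarrow> nat set \<Rightarrow> real).
              l = nat \<lceil>real n powr (\<delta> / (4 * (real t)\<^sup>2))\<rceil> \<and>
              (\<forall>i<l. fractional_clique_factor t n E (f i)) \<and>
              (\<forall>u v. E u v \<longrightarrow>
                 (\<Sum>i<l. \<Sum>T\<in>{T \<in> clique_copies t n E. {u, v} \<subseteq> T}. f i T) \<le> 1))"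
proof -
  obtain n0 :: nat where n0: "\<And>n. n \<ge> n0 \<Longrightarrow> 2 \<le> n"
      "\<And>n. n \<ge> n0 \<Longrightarrow> 2 * real n powr (1 - \<delta>) \<le> real n"
      "\<And>n. n \<ge> n0 \<Longrightarrow>
        16 * (real (2 * nat \<lceil>real n powr (\<delta> / (4 * (real t)\<^sup>2))\<rceil> * (t - 1))) ^ 3 \<le> real n"
    using threshold[OF assms] by blast
  show ?thesis
  proof (rule exI[of _ n0], intro allI impI)
    fix n d :: nat and lam :: real and E :: "nat \<Rightarrow> nat \<Rightarrow> bool"
    assume n: "n \<ge> n0" and d1: "d \<ge> 1" and ndl: "ndl_graph n d lam E"
      and dn: "real d \<le> real n powr (1 - \<delta>)"
      and lam: "lam \<le> 1 / (50 * real t * 4 ^ (t - 2)) * (real d ^ (t - 1) / real n ^ (t - 2))"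
    define l where "l = nat \<lceil>real n powr (\<delta> / (4 * (real t)\<^sup>2))\<rceil>"
    define r where "r = 2 * l * (t - 1)"
    have n2: "2 \<le> n" and r16: "16 * real r ^ 3 \<le> real n"
      using n0[OF n] by (auto simp: l_def r_def)
    have l0: "0 < l" using n2 by (simp add: l_def)
    have dn2: "2 * d \<le> n" using dn n0(2)[OF n] by linarith
    have "real d ^ (t - 1) / real n ^ (t - 2) = d * (real d / n) ^ (t - 2)"
    proof -
      have "t - 1 = Suc (t - 2)" using assms(1) by simp
      then show ?thesis by (simp add: power_divide)
    qed
    also have "\<dots> \<le> d * (real d / n) ^ 1"
      using dn2 n2 assms(1) by (intro mult_left_mono power_decreasing) auto
    finally have D: "real d ^ (t - 1) / real n ^ (t - 2) \<le> (real d)\<^sup>2 / n"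
      by (simp add: power2_eq_square)
    have "1 / (50 * real t * 4 ^ (t - 2)) \<le> 1"
    proof -
      have "1 * 1 \<le> (50 * real t) * 4 ^ (t - 2)" using assms(1) by (intro mult_mono) auto
      then show ?thesis using assms(1) by (simp add: divide_le_eq)
    qed
    then have "lam \<le> 1 * (real d ^ (t - 1) / real n ^ (t - 2))"
      using lam by (meson mult_right_mono order_trans divide_nonneg_nonneg of_nat_0_le_iff zero_le_power)
    then have lamD: "lam \<le> (real d)\<^sup>2 / n" using D by simp
    also have "\<dots> < d" using dn2 n2 d1 by (simp add: power2_eq_square field_simps)
    finally have lamd: "lam < d" .
    have d4: "real d \<le> 4 * lam\<^sup>2" by (rule degree_le_eigenvalue_square[OF ndl d1 lamd n2 dn2])
    then have lam0: "0 < lam"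
      using ndl_graph_contraction(2)[OF ndl d1 lamd n2, of "\<lambda>_. 0"] d1 by (cases "lam = 0") auto
    \<comment> \<open>Otherwise \<open>16 * lam^3 < n\<close>, and multiplying by \<open>lam\<close>
      gives \<open>16 * lam^4 < lam * n\<close>, which is at most \<open>d^2\<close> and hence at
      most \<open>16 * lam^4\<close>.\<close>
    have "real r \<le> lam"
    proof (rule ccontr)
      assume "\<not> ?thesis"
      then have "16 * lam ^ 3 < 16 * real r ^ 3" using lam0 by (simp add: power_strict_mono)
      also note r16
      finally have "lam * (16 * lam ^ 3) < lam * n" using lam0 by simp
      also have "\<dots> \<le> (real d)\<^sup>2" using lamD n2 by (simp add: field_simps)
      also have "\<dots> \<le> (4 * lam\<^sup>2)\<^sup>2" using d4 by (intro power_mono) auto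
      finally show False by (simp add: power2_eq_square power3_eq_cube)
    qed
    have G: "simple_graph n E" "regular_graph n d E" using ndl by (auto simp: ndl_graph_def)
    have factor: "\<exists>c. (\<forall>T\<in>clique_copies t n E'. 0 \<le> (c T :: real)) \<and>
          (\<forall>v<n. (\<Sum>T\<in>{T \<in> clique_copies t n E'. v \<in> T}. c T) = 1)"
      if E': "\<And>u v. E' u v \<Longrightarrow> E u v" "\<And>u v. E' u v \<Longrightarrow> E' v u"
        and removed: "\<And>u. u < n \<Longrightarrow> card {v. E u v \<and> \<not> E' u v} \<le> r" for E'
    proof -
      have removed': "real (card {v. E u v \<and> \<not> E' u v}) \<le> lam" if "u < n" for u
        using removed[OF that] \<open>real r \<le> lam\<close> by linarith
      have "\<exists>T\<in>clique_copies t n E'. T \<inter> A \<noteq> {} \<and> T \<inter> W = {}"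
        if "A \<subseteq> {..<n}" "W \<subseteq> {..<n}" "A \<noteq> {}" "A \<inter> W = {}" "card W < (t - 1) * card A" for A W
        using that d1 dn2 assms(1) lam0 lam G expander_mixing[OF ndl d1 lamd n2] E' removed'
        by (intro clique_expansion[of d n t lam E E' A W]) auto
      then obtain c where "\<And>T. T \<in> clique_copies t n E' \<Longrightarrow> 0 \<le> (c T :: real)"
          "\<And>v. v \<in> {..<n} \<Longrightarrow> (\<Sum>T\<in>{T \<in> clique_copies t n E'. v \<in> T}. c T) = 1"
        by (rule fractional_perfect_matching_of_expansion[of "{..<n}" "clique_copies t n E'" t, rotated 3])
           (use assms(1) in \<open>auto simp: clique_copies_def\<close>)
      then show ?thesis by auto
    qed
    \<comment> \<open>Packing \<open>2 * l\<close> factors with edge load 2 is enough: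
      \<open>l\<close> copies of their average load an edge by at most
      \<open>l * 2 / (2 * l) = 1\<close>.\<close>
    have "\<exists>g. (\<forall>T\<in>clique_copies t n E. 0 \<le> (g T :: real)) \<and>
        (\<forall>v<n. (\<Sum>T\<in>{T \<in> clique_copies t n E. v \<in> T}. g T) = real (2 * l)) \<and>
        (\<forall>u v. E u v \<longrightarrow> (\<Sum>T\<in>{T \<in> clique_copies t n E. {u, v} \<subseteq> T}. g T) \<le> 2)"
      by (rule low_load_packing[OF G(1), of r]; (rule factor)?) (simp_all add: r_def)
    then obtain g where g: "\<And>T. T \<in> clique_copies t n E \<Longrightarrow> 0 \<le> (g T :: real)"
        "\<And>v. v < n \<Longrightarrow> (\<Sum>T\<in>{T \<in> clique_copies t n E. v \<in> T}. g T) = real (2 * l)"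
        "\<And>u v. E u v \<Longrightarrow> (\<Sum>T\<in>{T \<in> clique_copies t n E. {u, v} \<subseteq> T}. g T) \<le> 2"
      by blast
    define f where "f = (\<lambda>T. g T / real (2 * l))"
    \<comment> \<open>The upper bound comes from the unit sum at any vertex of \<open>T\<close>, all
      terms being nonnegative.\<close>
    have "f T \<le> 1" if T: "T \<in> clique_copies t n E" for T
    proof -
      have "T \<noteq> {}" "T \<subseteq> {..<n}" using T assms(1) by (auto simp: clique_copies_def)
      then obtain v where "v \<in> T" "v < n" by blast
      then have "g T \<le> (\<Sum>T\<in>{T \<in> clique_copies t n E. v \<in> T}. g T)"
        using T g(1) by (intro member_le_sum) (auto simp: finite_clique_copies)
      then show ?thesis using g(2)[OF \<open>v < n\<close>] l0 by (simp add: f_def)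
    qed
    then have "fractional_clique_factor t n E f"
      using g l0 by (simp add: fractional_clique_factor_def f_def sum_divide_distrib[symmetric])
    moreover have "(\<Sum>i<l. \<Sum>T\<in>{T \<in> clique_copies t n E. {u, v} \<subseteq> T}. f T) \<le> 1" if "E u v" for u v
    proof -
      have "(\<Sum>i<l. \<Sum>T\<in>{T \<in> clique_copies t n E. {u, v} \<subseteq> T}. f T)
          = real l * ((\<Sum>T\<in>{T \<in> clique_copies t n E. {u, v} \<subseteq> T}. g T) / real (2 * l))"
        by (simp add: f_def sum_divide_distrib)
      then show ?thesis using g(3)[OF that] l0 by simp
    qed
    ultimately show "\<exists>(l :: nat) (f :: nat \<Rightarrow> nat set \<Rightarrow> real).
              l = nat \<lceil>real n powr (\<delta> / (4 * (real t)\<^sup>2))\<rceil> \<and>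
              (\<forall>i<l. fractional_clique_factor t n E (f i)) \<and>
              (\<forall>u v. E u v \<longrightarrow>
                 (\<Sum>i<l. \<Sum>T\<in>{T \<in> clique_copies t n E. {u, v} \<subseteq> T}. f i T) \<le> 1)"
      by (intro exI[of _ l] exI[of _ "\<lambda>_. f"]) (simp add: l_def)
  qed
qed

end
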